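(* For every integer $n\ge 1$, the Mostar index of the Fibonacci cube $\Gamma_n$ is $$\mathrm{Mo}(\Gamma_n)=\frac{1}{25}\Big((3n-2)f_{2n+2}+n f_{2n+1}+(3n+2)(-1)^n\Big).$$
   Context: Fibonacci numbers: $f_0=0$, $f_1=1$, $f_n=f_{n-1}+f_{n-2}$ for $n\ge 2$. Fibonacci cube: for $n\ge 1$, $\Gamma_n$ is the graph whose vertices are the binary strings $b_1b_2\ldots b_n\in\{0,1\}^n$ with $b_i\cdot b_{i+1}=0$ for all $1\le i\le n-1$ (no two consecutive 1s), two vertices being adjacent if and only if they differ in exactly one coordinate (i.e. the subgraph of the $n$-dimensional hypercube induced by these strings). Mostar index: for a graph $G$ and an edge $uv\in E(G)$, $n_u(G)$ is the number of vertices of $G$ that are strictly closer (in the shortest path metric of $G$) to $u$ than to $v$, and $n_v(G)$ is the number of vertices strictly closer to $v$ than to $u$. The Mostar index is $\mathrm{Mo}(G)=\sum_{uv\in E(G)}|n_u(G)-n_v(G)|$, the sum being over (unordered) edges. *)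

theory Defs
  imports
    Complex_Main
    "HOL-Number_Theory.Fib"
    "Graph_Theory.Pair_Digraph"
    "Graph_Theory.Shortest_Path"
begin

text \<open>As usual in \<open>Graph_Theory\<close>, a simple undirected graph is a symmetric loop-free pair digraph
  (\<^const>\<open>pair_graph\<close>): an undirected edge \<open>uv\<close> is the pair of arcs \<open>(u, v)\<close> and \<open>(v, u)\<close>.\<close>

text \<open>Minimal number of arcs of a walk from \<open>u\<close> to \<open>v\<close> (infinite if there is none).\<close>

definition graph_dist :: "'a pair_pre_digraph \<Rightarrow> 'a \<Rightarrow> 'a \<Rightarrow> ereal" where
  "graph_dist G u v = wf_digraph.\<mu> (with_proj G) (\<lambda>_. 1) u v"

definition undirected_edges :: "'a pair_pre_digraph \<Rightarrow> 'a set set" where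
  "undirected_edges G = {{u, v} | u v. (u, v) \<in> parcs G}"

definition num_closer :: "'a pair_pre_digraph \<Rightarrow> 'a \<Rightarrow> 'a \<Rightarrow> nat" where
  "num_closer G u v = card {w \<in> pverts G. graph_dist G w u < graph_dist G w v}"

text \<open>The value does not depend on which end of the edge is called \<open>u\<close>, see
  \<open>edge_imbalance_doubleton\<close> below.\<close>

definition edge_imbalance :: "'a pair_pre_digraph \<Rightarrow> 'a set \<Rightarrow> int" where
  "edge_imbalance G e =
     (THE c. \<exists>u v. e = {u, v} \<and> c = \<bar>int (num_closer G u v) - int (num_closer G v u)\<bar>)"

lemma edge_imbalance_doubleton:
  "edge_imbalance G {u, v} = \<bar>int (num_closer G u v) - int (num_closer G v u)\<bar>"
  unfolding edge_imbalance_def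
  by (rule the_equality) (auto simp: doubleton_eq_iff)

definition mostar_index :: "'a pair_pre_digraph \<Rightarrow> int" where
  "mostar_index G = (\<Sum>e\<in>undirected_edges G. edge_imbalance G e)"

text \<open>Binary strings are Boolean lists, with \<^term>\<open>True\<close> for the digit 1 and 0-based positions.\<close>

definition fib_strings :: "nat \<Rightarrow> bool list set" where
  "fib_strings n = {b. length b = n \<and> (\<forall>i. Suc i < n \<longrightarrow> \<not> (b ! i \<and> b ! Suc i))}"

definition fib_cube :: "nat \<Rightarrow> bool list pair_pre_digraph" where
  "fib_cube n = \<lparr> pverts = fib_strings n,
     parcs = {(x, y). x \<in> fib_strings n \<and> y \<in> fib_strings n \<and> card {i. i < n \<and> x ! i \<noteq> y ! i} = 1} \<rparr>"

lemma finite_fib_strings: "finite (fib_strings n)"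
  by (rule finite_subset[OF _ finite_lists_length_eq[of "UNIV :: bool set" n]])
     (auto simp: fib_strings_def)

lemma pair_graph_fib_cube: "pair_graph (fib_cube n)"
proof
  show "finite (pverts (fib_cube n))"
    by (simp add: fib_cube_def finite_fib_strings)
  show "finite (parcs (fib_cube n))"
    by (rule finite_subset[of _ "fib_strings n \<times> fib_strings n"])
       (auto simp: fib_cube_def finite_fib_strings)
  have "{i. i < n \<and> x ! i \<noteq> y ! i} = {i. i < n \<and> y ! i \<noteq> x ! i}" for x y :: "bool list"
    by auto
  then have "sym (parcs (fib_cube n))"
    unfolding fib_cube_def sym_def by auto
  then show "symmetric (with_proj (fib_cube n))"
    by (simp add: symmetric_def)
qed (auto simp: fib_cube_def)

end

theory Submission
  imports Defs
begin

text \<open>The Fibonacci cube is an isometric subgraph of the hypercube: between two Fibonacci strings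
  one can always move along a path that corrects one differing digit at a time
  (\<open>graph_dist_fib_cube\<close>). Hence a string \<open>w\<close> is closer to that end of an edge with which it
  agrees in the one position \<open>k\<close> where the ends differ (\<open>num_closer_fib_cube\<close>), and the two sides
  of the edge are the strings with digit 1 at \<open>k\<close> and those with digit 0 at \<open>k\<close>.

  With positions counted from 0, there are \<open>f (k + 2) * f (n - k + 1)\<close> strings with a 0 at \<open>k\<close>, since
  a 0 separates two independent Fibonacci strings, and by the addition law for Fibonacci numbers the
  strings with a 1 there number \<open>f (k + 1) * f (n - k)\<close>. The latter product also counts the edges in direction
  \<open>k\<close>, because clearing a 1 is always allowed. Writing \<open>P k = f k * f (n + 1 - k)\<close>, the index is
  therefore the sum of \<open>P k * (f (n + 2) - 2 * P k)\<close> over \<open>1 \<le> k \<le> n\<close>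
  (\<open>mostar_index_fib_cube\<close>).

  It remains to evaluate the convolutions of \<open>f\<close> with itself and of \<open>f\<^sup>2\<close> with itself. Both have
  closed forms in \<open>N\<close>, \<open>f N\<close>, \<open>f (N + 1)\<close>; they are proved by induction, together with the
  companion convolutions into which the recurrence leads. The doubling formulas for
  \<open>f (2 * n + 1)\<close> and \<open>f (2 * n + 2)\<close> and Cassini's identity for \<open>(- 1) ^ n\<close> turn the result
  into the stated one.\<close>

section \<open>Distances in the Fibonacci cube\<close>

definition hamming :: "nat \<Rightarrow> bool list \<Rightarrow> bool list \<Rightarrow> nat" where
  "hamming n x y = card {i. i < n \<and> x ! i \<noteq> y ! i}"

lemma hamming_same [simp]: "hamming n x x = 0"
  by (simp add: hamming_def)

lemma hamming_triangle: "hamming n x z \<le> hamming n x y + hamming n y z"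
proof -
  have "hamming n x z \<le> card ({i. i < n \<and> x ! i \<noteq> y ! i} \<union> {i. i < n \<and> y ! i \<noteq> z ! i})"
    unfolding hamming_def by (rule card_mono) auto
  also have "\<dots> \<le> hamming n x y + hamming n y z"
    unfolding hamming_def by (rule card_Un_le)
  finally show ?thesis .
qed

lemma hamming_flip:
  assumes "k < n" "length x = n" "x ! k \<noteq> y ! k"
  shows "hamming n x y = Suc (hamming n (x[k := y ! k]) y)"
proof -
  have "{i. i < n \<and> x ! i \<noteq> y ! i} = insert k {i. i < n \<and> x[k := y ! k] ! i \<noteq> y ! i}"
    using assms by (auto simp: nth_list_update)
  moreover have "k \<notin> {i. i < n \<and> x[k := y ! k] ! i \<noteq> y ! i}"
    using assms by simp
  ultimately show ?thesis
    by (simp add: hamming_def)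
qed

lemma parcs_fib_cube_iff:
  "(x, y) \<in> parcs (fib_cube n) \<longleftrightarrow> x \<in> fib_strings n \<and> y \<in> fib_strings n \<and> hamming n x y = 1"
  by (simp add: fib_cube_def hamming_def)

lemma pverts_fib_cube [simp]: "pverts (fib_cube n) = fib_strings n"
  by (simp add: fib_cube_def)

lemma length_fib_strings: "x \<in> fib_strings n \<Longrightarrow> length x = n"
  by (simp add: fib_strings_def)

lemma fib_strings_clear_bit:
  assumes "x \<in> fib_strings n"
  shows "x[k := False] \<in> fib_strings n"
  using assms by (cases "k < n") (auto simp: fib_strings_def nth_list_update)

text \<open>This makes geodesics of the hypercube available inside the Fibonacci cube. Clearing a digit is
  always safe; when no digit is to be cleared, all remaining flips only fill in digits of the target.\<close>

lemma ex_flip_towards: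
  assumes x: "x \<in> fib_strings n" and y: "y \<in> fib_strings n" and "x \<noteq> y"
  obtains k where "k < n" "x ! k \<noteq> y ! k" "x[k := y ! k] \<in> fib_strings n"
proof (cases "\<exists>k<n. x ! k \<and> \<not> y ! k")
  case True
  then obtain k where k: "k < n" "x ! k" "\<not> y ! k" by blast
  then show ?thesis
    using that[of k] fib_strings_clear_bit[OF x, of k] by simp
next
  case False
  obtain k where k: "k < n" "x ! k \<noteq> y ! k"
    using nth_equalityI[of x y] assms length_fib_strings[of x n] length_fib_strings[of y n] by auto
  \<comment> \<open>Every 1 of \<open>x\<close> is also a 1 of \<open>y\<close>, and this survives the flip, so two adjacent 1s
    after the flip would be two adjacent 1s of \<open>y\<close>.\<close>
  have below: "y ! i" if "i < n" "x[k := y ! k] ! i" for i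
    using False that k length_fib_strings[OF x] by (cases "i = k") auto
  have "\<not> (x[k := y ! k] ! i \<and> x[k := y ! k] ! Suc i)" if "Suc i < n" for i
    using below[of i] below[of "Suc i"] that y by (auto simp: fib_strings_def)
  then have "x[k := y ! k] \<in> fib_strings n"
    using x by (simp add: fib_strings_def)
  with k that show ?thesis by blast
qed

lemma hamming_eq_0D:
  assumes "x \<in> fib_strings n" "y \<in> fib_strings n" "hamming n x y = 0"
  shows "x = y"
proof (rule ccontr)
  assume "x \<noteq> y"
  then obtain k where "k < n" "x ! k \<noteq> y ! k"
    using ex_flip_towards assms(1,2) by blast
  then show False
    using hamming_flip[of k n x y] assms length_fib_strings[of x n] by simp
qed

text \<open>One arc changes the Hamming distance to a fixed string by at most 1, so no walk is shorter
  than the Hamming distance; flipping digits towards the target gives a walk that attains it.\<close>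

lemma graph_dist_fib_cube:
  assumes "x \<in> fib_strings n" "y \<in> fib_strings n"
  shows "graph_dist (fib_cube n) x y = ereal (real (hamming n x y))"
proof -
  interpret pair_graph "fib_cube n" by (rule pair_graph_fib_cube)
  have cost: "awalk_cost (\<lambda>_. 1) p = real (length p)" for p :: "(bool list \<times> bool list) list"
    by (induct p) auto
  have short: "hamming n u y \<le> length p" if "awalk u p y" for u p
    using that
  proof (induct p arbitrary: u)
    case Nil
    then show ?case by (simp add: awalk_Nil_iff)
  next
    case (Cons e p)
    then have "hamming n u (snd e) = 1" "hamming n (snd e) y \<le> length p"
      using parcs_fib_cube_iff[of "fst e" "snd e" n] by (auto simp: awalk_Cons_iff)
    then show ?case
      using hamming_triangle[of n u y "snd e"] by simp
  qed
  have geodesic: "\<exists>p. awalk u p y \<and> length p = hamming n u y" if "u \<in> fib_strings n" for u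
    using that
  proof (induct "hamming n u y" arbitrary: u)
    case 0
    then have "u = y" using assms(2) hamming_eq_0D by metis
    then show ?case using 0 by (intro exI[of _ "[]"]) (simp add: awalk_Nil_iff)
  next
    case (Suc d)
    then have "u \<noteq> y" by auto
    then obtain k where k: "k < n" "u ! k \<noteq> y ! k" and z: "u[k := y ! k] \<in> fib_strings n"
      using ex_flip_towards Suc.prems assms(2) by metis
    let ?z = "u[k := y ! k]"
    have step: "hamming n u y = Suc (hamming n ?z y)"
      using hamming_flip k Suc.prems length_fib_strings by metis
    then obtain p where p: "awalk ?z p y" "length p = hamming n ?z y"
      using Suc z by (metis nat.inject)
    have "hamming n u ?z = Suc (hamming n ?z ?z)"
      using hamming_flip[of k n u ?z] k length_fib_strings[OF Suc.prems] by simp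
    then have "(u, ?z) \<in> parcs (fib_cube n)"
      using Suc.prems z by (simp add: parcs_fib_cube_iff)
    then show ?case
      using p step Suc.prems by (intro exI[of _ "(u, ?z) # p"]) (simp add: awalk_Cons_iff)
  qed
  have "\<mu> (\<lambda>_. 1) x y = ereal (real (hamming n x y))"
  proof (rule antisym)
    obtain p where "awalk x p y" "length p = hamming n x y"
      using geodesic assms(1) by blast
    then show "\<mu> (\<lambda>_. 1) x y \<le> ereal (real (hamming n x y))"
      using min_cost_le_walk_cost[of x p y "\<lambda>_. 1"] cost[of p] by simp
    show "ereal (real (hamming n x y)) \<le> \<mu> (\<lambda>_. 1) x y"
      unfolding \<mu>_def by (rule INF_greatest) (auto simp: cost dest: short)
  qed
  then show ?thesis by (simp add: graph_dist_def)
qed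

section \<open>The two sides of an edge\<close>

text \<open>Away from position \<open>k\<close> the ends of the edge agree, so only the digit at \<open>k\<close> decides which end
  has the smaller Hamming distance to \<open>w\<close>.\<close>

lemma num_closer_fib_cube:
  assumes u: "u \<in> fib_strings n" and v: "v \<in> fib_strings n"
    and k: "k < n" and flip: "v = u[k := \<not> u ! k]"
  shows "num_closer (fib_cube n) u v = card {w \<in> fib_strings n. w ! k = u ! k}"
proof -
  have "graph_dist (fib_cube n) w u < graph_dist (fib_cube n) w v \<longleftrightarrow> w ! k = u ! k"
    if w: "w \<in> fib_strings n" for w
  proof -
    have sym: "hamming n a b = hamming n b a" for a b
      unfolding hamming_def by (rule arg_cong[where f = card]) auto
    have len: "length u = n" "length v = n"
      using u v by (simp_all add: length_fib_strings)
    have "hamming n v w = Suc (hamming n u w)" if "w ! k = u ! k"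
      using hamming_flip[of k n v w] that k len flip by simp
    moreover have "hamming n u w = Suc (hamming n v w)" if "w ! k \<noteq> u ! k"
      using hamming_flip[of k n u w] that k len flip by (cases "u ! k") simp_all
    ultimately show ?thesis
      unfolding graph_dist_fib_cube[OF w u] graph_dist_fib_cube[OF w v]
      by (cases "w ! k = u ! k") (simp_all add: sym[of w])
  qed
  then show ?thesis
    unfolding num_closer_def by (intro arg_cong[where f = card]) auto
qed

text \<open>Each edge is recorded once, by its direction \<open>k\<close> and the end with digit 1 at \<open>k\<close>. This turns
  the sum over two-element sets into a double sum over directions and strings.\<close>

lemma undirected_edges_fib_cube:
  "undirected_edges (fib_cube n) =
     (\<lambda>(k, v). {v, v[k := False]}) ` (SIGMA k:{..<n}. {v \<in> fib_strings n. v ! k})"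
    (is "?E = ?h ` ?A")
proof
  show "?E \<subseteq> ?h ` ?A"
  proof
    fix e assume "e \<in> ?E"
    then obtain x y where e: "e = {x, y}" and x: "x \<in> fib_strings n" and y: "y \<in> fib_strings n"
      and ham: "hamming n x y = 1"
      by (auto simp: undirected_edges_def parcs_fib_cube_iff)
    obtain k where "{i. i < n \<and> x ! i \<noteq> y ! i} = {k}"
      using ham unfolding hamming_def by (auto simp: card_1_singleton_iff)
    then have k: "k < n" "x ! k \<noteq> y ! k" and rest: "\<And>i. i < n \<Longrightarrow> i \<noteq> k \<Longrightarrow> x ! i = y ! i"
      by auto
    have len: "length x = n" "length y = n"
      using x y by (simp_all add: length_fib_strings)
    show "e \<in> ?h ` ?A"
    proof (cases "x ! k")
      case True
      then have "y = x[k := False]"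
        using k rest len by (intro nth_equalityI) (auto simp: nth_list_update)
      then show ?thesis using e x k True by (intro image_eqI[of _ _ "(k, x)"]) auto
    next
      case False
      then have "x = y[k := False]"
        using k rest len by (intro nth_equalityI) (auto simp: nth_list_update)
      then show ?thesis using e y k False by (intro image_eqI[of _ _ "(k, y)"]) auto
    qed
  qed
  show "?h ` ?A \<subseteq> ?E"
  proof clarify
    fix k v assume k: "k < n" and v: "v \<in> fib_strings n" "v ! k"
    then have "hamming n v (v[k := False]) = 1"
      using hamming_flip[of k n v "v[k := False]"] by (simp add: length_fib_strings)
    then show "{v, v[k := False]} \<in> ?E"
      using v fib_strings_clear_bit[OF v(1), of k]
      by (auto simp: undirected_edges_def parcs_fib_cube_iff)
  qed
qed

lemma inj_on_edge_of_upper_end: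
  "inj_on (\<lambda>(k, v). {v, v[k := False]}) (SIGMA k:{..<n}. {v \<in> fib_strings n. v ! k})"
proof (rule inj_onI, clarify)
  fix k v k' v'
  assume k: "k < n" and v: "v \<in> fib_strings n" "v ! k"
    and k': "k' < n" and v': "v' \<in> fib_strings n" "v' ! k'"
    and eq: "{v, v[k := False]} = {v', v'[k' := False]}"
  have len: "length v = n" "length v' = n"
    using v v' by (simp_all add: length_fib_strings)
  from eq consider "v = v'" "v[k := False] = v'[k' := False]"
    | "v = v'[k' := False]" "v' = v[k := False]"
    by (auto simp: doubleton_eq_iff)
  then show "k = k' \<and> v = v'"
  proof cases
    case 1
    then have "\<not> v[k' := False] ! k" using k len by (metis nth_list_update_eq)
    then show ?thesis using 1 v by (cases "k = k'") auto
  next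
    case 2
    have "\<not> v' ! k" using k len 2(2) by simp
    then have "\<not> v ! k" using k' len 2(1) by (simp add: nth_list_update)
    then show ?thesis using v by simp
  qed
qed

section \<open>Counting Fibonacci strings\<close>

lemma fib_strings_0: "fib_strings 0 = {[]}"
  by (auto simp: fib_strings_def)

lemma fib_strings_append_False_iff:
  assumes "length x = k"
  shows "x @ False # y \<in> fib_strings (k + Suc m) \<longleftrightarrow> x \<in> fib_strings k \<and> y \<in> fib_strings m"
proof
  assume L: "x @ False # y \<in> fib_strings (k + Suc m)"
  then have ok: "\<not> ((x @ False # y) ! i \<and> (x @ False # y) ! Suc i)" if "Suc i < k + Suc m" for i
    using that by (simp add: fib_strings_def)
  have "\<not> (x ! i \<and> x ! Suc i)" if "Suc i < k" for i
    using ok[of i] that assms by (simp add: nth_append)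
  moreover have "\<not> (y ! i \<and> y ! Suc i)" if "Suc i < m" for i
    using ok[of "k + Suc i"] that assms by (simp add: nth_append)
  ultimately show "x \<in> fib_strings k \<and> y \<in> fib_strings m"
    using L assms by (simp add: fib_strings_def)
next
  assume R: "x \<in> fib_strings k \<and> y \<in> fib_strings m"
  have "\<not> ((x @ False # y) ! i \<and> (x @ False # y) ! Suc i)" if "Suc i < k + Suc m" for i
  proof -
    consider "Suc i < k" | "Suc i = k" | "i = k" | j where "i = k + Suc j"
      by (metis add_Suc_right less_imp_Suc_add linorder_neqE_nat not_less_eq)
    then show ?thesis
      using R assms that by cases (auto simp: fib_strings_def nth_append)
  qed
  then show "x @ False # y \<in> fib_strings (k + Suc m)"
    using R by (simp add: fib_strings_def)
qed

text \<open>The blocks on both sides of a 0 do not constrain each other, so cutting there is a bijection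
  onto pairs of Fibonacci strings.\<close>

lemma card_fib_strings_zero_between:
  "card {w \<in> fib_strings (k + Suc m). \<not> w ! k} = card (fib_strings k) * card (fib_strings m)"
proof -
  let ?h = "\<lambda>(x, y). x @ False # y"
  have "bij_betw ?h (fib_strings k \<times> fib_strings m) {w \<in> fib_strings (k + Suc m). \<not> w ! k}"
  proof (rule bij_betw_imageI)
    show "inj_on ?h (fib_strings k \<times> fib_strings m)"
      by (auto simp: inj_on_def fib_strings_def)
    show "?h ` (fib_strings k \<times> fib_strings m) = {w \<in> fib_strings (k + Suc m). \<not> w ! k}"
    proof (intro equalityI subsetI)
      fix w assume "w \<in> ?h ` (fib_strings k \<times> fib_strings m)"
      then obtain x y where "w = x @ False # y" "x \<in> fib_strings k" "y \<in> fib_strings m"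
        by auto
      then show "w \<in> {w \<in> fib_strings (k + Suc m). \<not> w ! k}"
        using fib_strings_append_False_iff[of x k y m] length_fib_strings[of x k]
        by (simp add: nth_append)
    next
      fix w assume "w \<in> {w \<in> fib_strings (k + Suc m). \<not> w ! k}"
      then have w: "w \<in> fib_strings (k + Suc m)" "\<not> w ! k" by auto
      have split: "w = take k w @ False # drop (Suc k) w"
        using id_take_nth_drop[of k w] w length_fib_strings[OF w(1)] by simp
      have "length (take k w) = k" using length_fib_strings[OF w(1)] by simp
      then have "(take k w, drop (Suc k) w) \<in> fib_strings k \<times> fib_strings m"
        using fib_strings_append_False_iff[of "take k w" k "drop (Suc k) w" m] w split by auto
      then show "w \<in> ?h ` (fib_strings k \<times> fib_strings m)"
        using split by (intro image_eqI[of _ _ "(take k w, drop (Suc k) w)"]) auto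
    qed
  qed
  from bij_betw_same_card[OF this] show ?thesis
    by (simp add: card_cartesian_product)
qed

text \<open>A leading 1 forces a 0 in the second place. Together with the strings with a leading 0 this
  gives the Fibonacci recurrence for the number of all strings.\<close>

lemma card_fib_strings_one_at_0:
  "card {w \<in> fib_strings (Suc (Suc n)). w ! 0} = card (fib_strings n)"
proof -
  have one: "[True] \<in> fib_strings 1"
    by (simp add: fib_strings_def)
  have "{w \<in> fib_strings (Suc (Suc n)). w ! 0} = (\<lambda>x. True # False # x) ` fib_strings n"
  proof (intro equalityI subsetI)
    fix w assume w: "w \<in> {w \<in> fib_strings (Suc (Suc n)). w ! 0}"
    then obtain x where x: "w = True # False # x"
      by (auto simp: fib_strings_def length_Suc_conv)
    then show "w \<in> (\<lambda>x. True # False # x) ` fib_strings n"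
      using w fib_strings_append_False_iff[of "[True]" 1 x n] one by auto
  next
    fix w assume "w \<in> (\<lambda>x. True # False # x) ` fib_strings n"
    then show "w \<in> {w \<in> fib_strings (Suc (Suc n)). w ! 0}"
      using fib_strings_append_False_iff[of "[True]" 1 _ n] one by auto
  qed
  then show ?thesis
    by (simp add: card_image inj_on_def)
qed

lemma card_fib_strings_split:
  "card {w \<in> fib_strings n. w ! k} + card {w \<in> fib_strings n. \<not> w ! k} = card (fib_strings n)"
proof -
  have "fib_strings n = {w \<in> fib_strings n. w ! k} \<union> {w \<in> fib_strings n. \<not> w ! k}"
    by auto
  then show ?thesis
    by (metis (no_types, lifting) card_Un_disjoint disjoint_iff finite_Un finite_fib_strings
        mem_Collect_eq)
qed

lemma card_fib_strings: "card (fib_strings n) = fib (n + 2)"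
proof (induct n rule: fib.induct)
  case 1
  then show ?case by (simp add: fib_strings_0 numeral_2_eq_2)
next
  case 2
  have "fib_strings (Suc 0) = {[False], [True]}"
    by (auto simp: fib_strings_def length_Suc_conv)
  then show ?case by (simp add: numeral_eq_Suc)
next
  case (3 n)
  have "card (fib_strings (Suc (Suc n))) = card (fib_strings n) + card (fib_strings (Suc n))"
    using card_fib_strings_split[of "Suc (Suc n)" 0] card_fib_strings_one_at_0[of n]
      card_fib_strings_zero_between[of 0 "Suc n"] by (simp add: fib_strings_0)
  then show ?case using 3 by simp
qed

lemma card_fib_strings_zero_at:
  assumes "k < n"
  shows "card {w \<in> fib_strings n. \<not> w ! k} = fib (k + 2) * fib (n - k + 1)"
proof -
  obtain m where "n = k + Suc m" using less_imp_Suc_add[OF assms] by auto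
  then show ?thesis using card_fib_strings_zero_between[of k m] by (simp add: card_fib_strings)
qed

text \<open>Counting the complement of the strings with a 0 at \<open>k\<close> avoids a case distinction on whether
  \<open>k\<close> is the first or the last position.\<close>

lemma card_fib_strings_one_at:
  assumes "k < n"
  shows "card {w \<in> fib_strings n. w ! k} = fib (k + 1) * fib (n - k)"
proof -
  obtain m where n: "n = k + Suc m" using less_imp_Suc_add[OF assms] by auto
  have "fib (n + 2) = fib (k + 2) * fib (n - k + 1) + fib (k + 1) * fib (n - k)"
    using fib_add[of "k + 1" "m + 1"] n by (simp add: mult.commute del: fib.simps)
  then show ?thesis
    using card_fib_strings_split[of n k] card_fib_strings_zero_at[OF assms] card_fib_strings[of n]
    by linarith
qed

section \<open>Convolutions of Fibonacci numbers\<close>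

text \<open>Shifting \<open>N\<close> acts on the second factor alone, up to a boundary term, and sends
  \<open>(f j, f (j + 1))\<close> to \<open>(f (j + 1), f j + f (j + 1))\<close>. The two sums therefore satisfy a linear
  recurrence, driven by \<open>f (N + 1)\<close>, which explains the factor \<open>N\<close> in the solution.\<close>

lemma fib_convolution:
  fixes N :: nat and a b :: real
  defines "a \<equiv> real (fib N)" and "b \<equiv> real (fib (N + 1))"
  shows "5 * (\<Sum>k\<le>N. real (fib k) * real (fib (N - k))) = N * (2 * b - a) - a" (is "?A N")
    and "5 * (\<Sum>k\<le>N. real (fib k) * real (fib (N - k + 1))) = N * (2 * a + b) + 2 * a" (is "?B N")
proof -
  show "?A N" "?B N"
    unfolding assms
  proof (induct N)
    case (Suc N)
    have "(\<Sum>k\<le>Suc N. real (fib k) * real (fib (Suc N - k)))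
        = (\<Sum>k\<le>N. real (fib k) * real (fib (N - k + 1)))"
      by (simp add: Suc_diff_le)
    moreover have "(\<Sum>k\<le>Suc N. real (fib k) * real (fib (Suc N - k + 1)))
        = (\<Sum>k\<le>N. real (fib k) * real (fib (N - k + 1)))
          + (\<Sum>k\<le>N. real (fib k) * real (fib (N - k))) + real (fib (Suc N))"
      by (simp add: Suc_diff_le sum.distrib algebra_simps)
    ultimately show "5 * (\<Sum>k\<le>Suc N. real (fib k) * real (fib (Suc N - k)))
        = real (Suc N) * (2 * real (fib (Suc N + 1)) - real (fib (Suc N))) - real (fib (Suc N))"
      "5 * (\<Sum>k\<le>Suc N. real (fib k) * real (fib (Suc N - k + 1)))
        = real (Suc N) * (2 * real (fib (Suc N)) + real (fib (Suc N + 1))) + 2 * real (fib (Suc N))"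
      using Suc by (simp_all add: algebra_simps)
  qed simp_all
qed

text \<open>As for the previous convolution, now with the three products of degree 2 in \<open>f j\<close> and
  \<open>f (j + 1)\<close>, whose span is preserved by the shift. The homogeneous recurrence is already solved by
  quadratic forms in \<open>f N\<close> and \<open>f (N + 1)\<close>; the driving term \<open>(f (N + 1))\<^sup>2\<close> resonates and
  contributes \<open>N\<close> times such forms. The coefficients come from solving the resulting linear
  equations.\<close>

lemma fib_square_convolution:
  fixes N :: nat and a b :: real
  defines "a \<equiv> real (fib N)" and "b \<equiv> real (fib (N + 1))"
  shows "25 * (\<Sum>k\<le>N. (real (fib k))\<^sup>2 * (real (fib (N - k)))\<^sup>2)
           = 2 * a * b - a\<^sup>2 + N * (6 * b\<^sup>2 - 6 * a * b - a\<^sup>2)" (is "?U N")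
    and "25 * (\<Sum>k\<le>N. (real (fib k))\<^sup>2 * (real (fib (N - k)) * real (fib (N - k + 1))))
           = a * b - 3 * a\<^sup>2 + N * (3 * b\<^sup>2 + 2 * a * b - 3 * a\<^sup>2)" (is "?V N")
    and "25 * (\<Sum>k\<le>N. (real (fib k))\<^sup>2 * (real (fib (N - k + 1)))\<^sup>2)
           = 8 * a * b + 6 * a\<^sup>2 + N * (6 * a * b + 6 * a\<^sup>2 - b\<^sup>2)" (is "?W N")
proof -
  define U V W where
    "U N = (\<Sum>k\<le>N. (real (fib k))\<^sup>2 * (real (fib (N - k)))\<^sup>2)" and
    "V N = (\<Sum>k\<le>N. (real (fib k))\<^sup>2 * (real (fib (N - k)) * real (fib (N - k + 1))))" and
    "W N = (\<Sum>k\<le>N. (real (fib k))\<^sup>2 * (real (fib (N - k + 1)))\<^sup>2)" for N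
  have U: "U (Suc N) = W N" for N
    by (simp add: U_def W_def Suc_diff_le)
  have V: "V (Suc N) = V N + W N" for N
    by (simp add: V_def W_def Suc_diff_le sum.distrib[symmetric] algebra_simps power2_eq_square)
  have W: "W (Suc N) = U N + 2 * V N + W N + (real (fib (Suc N)))\<^sup>2" for N
    by (simp add: U_def V_def W_def Suc_diff_le sum.distrib[symmetric] sum_distrib_left
        algebra_simps power2_eq_square)
  have "25 * U N = 2 * real (fib N) * real (fib (N + 1)) - (real (fib N))\<^sup>2
          + N * (6 * (real (fib (N + 1)))\<^sup>2 - 6 * real (fib N) * real (fib (N + 1)) - (real (fib N))\<^sup>2)
      \<and> 25 * V N = real (fib N) * real (fib (N + 1)) - 3 * (real (fib N))\<^sup>2
          + N * (3 * (real (fib (N + 1)))\<^sup>2 + 2 * real (fib N) * real (fib (N + 1)) - 3 * (real (fib N))\<^sup>2)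
      \<and> 25 * W N = 8 * real (fib N) * real (fib (N + 1)) + 6 * (real (fib N))\<^sup>2
          + N * (6 * real (fib N) * real (fib (N + 1)) + 6 * (real (fib N))\<^sup>2 - (real (fib (N + 1)))\<^sup>2)"
  proof (induct N)
    case 0
    show ?case by (simp add: U_def V_def W_def)
  next
    case (Suc N)
    define a b where "a = real (fib N)" and "b = real (fib (N + 1))"
    have fib: "real (fib N) = a" "real (fib (Suc N)) = b" "real (fib (N + 1)) = b"
      "real (fib (Suc N + 1)) = a + b"
      by (simp_all add: a_def b_def)
    show ?case
      using Suc unfolding U V W fib of_nat_Suc by (auto simp: algebra_simps power2_eq_square)
  qed
  then show "?U N" "?V N" "?W N"
    unfolding a_def b_def U_def V_def W_def by blast+
qed

lemma fib_cassini_real: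
  "(-1) ^ n = (real (fib (n + 1)))\<^sup>2 - real (fib n) * real (fib (n + 1)) - (real (fib n))\<^sup>2"
  by (induct n) (simp_all add: algebra_simps power2_eq_square)

section \<open>The Mostar index\<close>

text \<open>In direction \<open>k\<close> all edges have the same imbalance, the number \<open>Z\<close> of strings with
  a 0 at \<open>k\<close> minus the number \<open>O\<close> of those with a 1. The form \<open>f (n + 2) - 2 * O\<close> comes from \<open>Z + O = f (n + 2)\<close>, and the factor in
  front is \<open>O\<close> again, as the number of edges in direction \<open>k\<close>.\<close>

lemma mostar_index_fib_cube:
  "real_of_int (mostar_index (fib_cube n)) =
     (\<Sum>k<n. real (fib (k + 1) * fib (n - k)) *
            (real (fib (n + 2)) - 2 * real (fib (k + 1) * fib (n - k))))"
proof -
  define ones where "ones k = {w \<in> fib_strings n. w ! k}" for k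
  have fin: "finite (ones k)" for k
    by (simp add: ones_def finite_fib_strings)
  have card_ones: "card (ones k) = fib (k + 1) * fib (n - k)" if "k < n" for k
    using card_fib_strings_one_at[OF that] by (simp add: ones_def)
  have imbalance: "edge_imbalance (fib_cube n) {v, v[k := False]}
      = int (fib (n + 2)) - 2 * int (fib (k + 1) * fib (n - k))"
    if k: "k < n" and v: "v \<in> ones k" for k v
  proof -
    let ?u = "v[k := False]"
    have fs: "v \<in> fib_strings n" "v ! k" "?u \<in> fib_strings n"
      using v fib_strings_clear_bit by (auto simp: ones_def)
    have uk: "\<not> ?u ! k"
      using k length_fib_strings[OF fs(1)] by simp
    have flips: "?u = v[k := \<not> v ! k]" "v = ?u[k := \<not> ?u ! k]"
      using fs(2) uk list_update_id[of v k] by simp_all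
    have "num_closer (fib_cube n) v ?u = card {w \<in> fib_strings n. w ! k}"
      unfolding num_closer_fib_cube[OF fs(1,3) k flips(1)] using fs(2) by simp
    moreover have "num_closer (fib_cube n) ?u v = card {w \<in> fib_strings n. \<not> w ! k}"
      unfolding num_closer_fib_cube[OF fs(3,1) k flips(2)] using uk by simp
    moreover have "card {w \<in> fib_strings n. w ! k} \<le> card {w \<in> fib_strings n. \<not> w ! k}"
      unfolding card_fib_strings_one_at[OF k] card_fib_strings_zero_at[OF k]
      by (intro mult_le_mono fib_mono) simp_all
    ultimately show ?thesis
      using card_fib_strings_split[of n k] card_fib_strings_one_at[OF k] card_fib_strings[of n]
      unfolding edge_imbalance_doubleton by linarith
  qed
  have "mostar_index (fib_cube n) =
      (\<Sum>(k, v)\<in>(SIGMA k:{..<n}. ones k). edge_imbalance (fib_cube n) {v, v[k := False]})"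
    unfolding mostar_index_def undirected_edges_fib_cube ones_def
    by (subst sum.reindex[OF inj_on_edge_of_upper_end]) (simp add: case_prod_beta)
  also have "\<dots> = (\<Sum>k<n. \<Sum>v\<in>ones k. edge_imbalance (fib_cube n) {v, v[k := False]})"
    using fin by (subst sum.Sigma) auto
  also have "\<dots> = (\<Sum>k<n. int (fib (k + 1) * fib (n - k)) *
      (int (fib (n + 2)) - 2 * int (fib (k + 1) * fib (n - k))))"
    by (rule sum.cong) (simp_all add: imbalance card_ones)
  finally show ?thesis by simp
qed

theorem theorem3:
  fixes n :: nat
  assumes "n \<ge> 1"
  shows "real_of_int (mostar_index (fib_cube n)) =
    1 / 25 * ((3 * real n - 2) * real (fib (2 * n + 2)) + real n * real (fib (2 * n + 1))
              + (3 * real n + 2) * (- 1) ^ n)"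
proof -
  define P where "P k = real (fib k) * real (fib (n + 1 - k))" for k
  \<comment> \<open>The end terms \<open>P 0\<close> and \<open>P (n + 1)\<close> vanish because \<open>fib 0 = 0\<close>, so the sum may run over
    the full range of the convolution.\<close>
  have ends: "(\<Sum>k<n. g (P (k + 1))) = (\<Sum>k\<le>n + 1. g (P k))" if "g 0 = 0" for g :: "real \<Rightarrow> real"
  proof -
    have "(\<Sum>k\<le>n + 1. g (P k)) = (\<Sum>k\<le>n. g (P (k + 1)))"
      using sum.atMost_Suc_shift[of "\<lambda>k. g (P k)" n] that by (simp add: P_def)
    also have "\<dots> = (\<Sum>k<n. g (P (k + 1)))"
      using that by (simp add: lessThan_Suc_atMost[symmetric] P_def)
    finally show ?thesis by simp
  qed
  define a b where "a = real (fib n)" and "b = real (fib (n + 1))"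
  have fib: "real (fib n) = a" "real (fib (n + 1)) = b" "real (fib (n + 2)) = a + b" "real (fib (n + 1 + 1)) = a + b"
    by (simp_all add: a_def b_def)
  have lin: "5 * (\<Sum>k\<le>n + 1. P k) = (n + 1) * (2 * a + b) - b"
    using fib_convolution(1)[of "n + 1"] unfolding fib P_def by (simp add: algebra_simps)
  have quad: "25 * (\<Sum>k\<le>n + 1. (P k)\<^sup>2) =
      2 * b * (a + b) - b\<^sup>2 + (n + 1) * (6 * (a + b)\<^sup>2 - 6 * b * (a + b) - b\<^sup>2)"
    using fib_square_convolution(1)[of "n + 1"] unfolding fib P_def power_mult_distrib by simp
  have odd: "real (fib (2 * n + 1)) = a\<^sup>2 + b\<^sup>2"
    using fib_add[of n n] by (simp add: a_def b_def mult_2 power2_eq_square)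
  have "fib (2 * n + 2) = fib (n + 2) * fib (n + 1) + fib (n + 1) * fib n"
    using fib_add[of n "n + 1"] by (simp add: mult_2 del: fib.simps)
  then have even: "real (fib (2 * n + 2)) = b * (2 * a + b)"
    by (simp only: of_nat_add of_nat_mult fib) (simp add: algebra_simps)
  have cassini: "(-1) ^ n = b\<^sup>2 - a * b - a\<^sup>2"
    using fib_cassini_real[of n] by (simp add: a_def b_def)
  have "real_of_int (mostar_index (fib_cube n)) = (\<Sum>k<n. P (k + 1) * ((a + b) - 2 * P (k + 1)))"
    unfolding mostar_index_fib_cube fib P_def by simp
  also have "\<dots> = (\<Sum>k\<le>n + 1. P k * ((a + b) - 2 * P k))"
    by (rule ends) simp
  also have "\<dots> = (a + b) * (\<Sum>k\<le>n + 1. P k) - 2 * (\<Sum>k\<le>n + 1. (P k)\<^sup>2)"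
    by (simp add: sum_subtractf sum_distrib_left algebra_simps power2_eq_square)
  finally have "25 * real_of_int (mostar_index (fib_cube n)) =
      5 * (a + b) * (5 * (\<Sum>k\<le>n + 1. P k)) - 2 * (25 * (\<Sum>k\<le>n + 1. (P k)\<^sup>2))"
    by (simp add: algebra_simps)
  also have "\<dots> = (3 * real n - 2) * real (fib (2 * n + 2)) + real n * real (fib (2 * n + 1))
      + (3 * real n + 2) * (- 1) ^ n"
    unfolding lin quad odd even cassini by (simp add: algebra_simps power2_eq_square)
  finally show ?thesis by simp
qed

end
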